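(* Let $c=1/(12\pi^2 e)$. For integers $n\ge 4$ and $r$ with $1\le r\le c\,n(\log n)^{-1}(\log\log n)^{-2}$, let $x=x(n,r)$ be the positive solution to the equation $\sum_{j=1}^r x^j=n$. Then $$\nu(n,r)=\frac{\exp\left\{\sum_{j=1}^r x^j/j\right\}}{x^n\sqrt{2\pi\sum_{j=1}^r jx^j}}\left(1+O\left(\frac rn\right)\right).$$
   Context: $S_n$ is the symmetric group on $n$ symbols and $k_j(\sigma)$ is the number of cycles of length $j$ in $\sigma\in S_n$. For $1\le r\le n$, $$\nu(n,r)=\frac1{n!}\left|\{\sigma\in S_n:\ k_j(\sigma)=0 \text{ for all } r+1\le j\le n\}\right|.$$ The implied constant in $O(\cdot)$ is absolute (uniform over all $n,r$ in the stated range). $\log$ is the natural logarithm. *)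

theory Defs
  imports Complex_Main "HOL-Combinatorics.Orbits"
begin

text \<open>
  $S_n$ is the set of permutations of \<open>{1..n}\<close>. The orbits of \<open>\<sigma>\<close> on \<open>{1..n}\<close> are the
  supports of its cycles; fixed points count as cycles of length 1.
\<close>

definition num_cycles :: "nat \<Rightarrow> (nat \<Rightarrow> nat) \<Rightarrow> nat \<Rightarrow> nat" where
  "num_cycles n \<sigma> j = card {C \<in> orbit \<sigma> ` {1..n}. card C = j}"

definition nu :: "nat \<Rightarrow> nat \<Rightarrow> real" where
  "nu n r = real (card {\<sigma>. \<sigma> permutes {1..n} \<and> (\<forall>j\<in>{r+1..n}. num_cycles n \<sigma> j = 0)}) / fact n"

definition saddle_point :: "nat \<Rightarrow> nat \<Rightarrow> real" where
  "saddle_point n r = (THE x. 0 < x \<and> (\<Sum>j=1..r. x ^ j) = real n)"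

lemma ex1_saddle_point:
  assumes "1 \<le> n" "1 \<le> r"
  shows "\<exists>!x::real. 0 < x \<and> (\<Sum>j=1..r. x ^ j) = real n"
proof -
  define f :: "real \<Rightarrow> real" where "f = (\<lambda>x. \<Sum>j=1..r. x ^ j)"
  have less: "f x < f y" if "0 < x" "x < y" for x y
    unfolding f_def
  proof (rule sum_strict_mono)
    show "x ^ j < y ^ j" if "j \<in> {1..r}" for j
      using that \<open>0 < x\<close> \<open>x < y\<close> by (intro power_strict_mono) auto
  qed (use assms in auto)
  have f0: "f 0 = 0"
    unfolding f_def by (intro sum.neutral) auto
  have "real n = (\<Sum>j\<in>{1}. real n ^ j)" by simp
  also have "\<dots> \<le> f (real n)"
    unfolding f_def using assms by (intro sum_mono2) auto
  finally have fn: "real n \<le> f (real n)" .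
  have "\<exists>x\<ge>0. x \<le> real n \<and> f x = real n"
    by (rule IVT) (use f0 fn in \<open>auto simp: f_def intro!: continuous_intros\<close>)
  then obtain x where x: "0 \<le> x" "f x = real n" by blast
  then have "0 < x" using f0 assms by (cases "x = 0") auto
  moreover have "y = x" if "0 < y" "f y = real n" for y
    using less[of x y] less[of y x] that x \<open>0 < x\<close> by (cases x y rule: linorder_cases) auto
  ultimately show ?thesis
    using x unfolding f_def by blast
qed

lemma saddle_point:
  assumes "1 \<le> n" "1 \<le> r"
  shows "0 < saddle_point n r" "(\<Sum>j=1..r. saddle_point n r ^ j) = real n"
  using theI'[OF ex1_saddle_point[OF assms]] unfolding saddle_point_def by auto

end

theory Submission
  imports Defs "HOL-Probability.Probability" "HOL-Complex_Analysis.Complex_Analysis" "HOL-Real_Asymp.Real_Asymp"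
begin


text \<open>
The proof is the saddle point method. The numbers \<open>\<nu>(n, r)\<close>, with \<open>r\<close> fixed, are the power series
coefficients of the entire function \<open>exp (\<Sum>j=1..r. z ^ j / j)\<close>. Cauchy's formula on the circle of
radius \<open>x\<close> turns \<open>\<nu>(n, r)\<close> into \<open>exp (\<Sum>j=1..r. x ^ j / j) / (2 \<pi> x ^ n)\<close> times the integral over
\<open>[-\<pi>, \<pi>]\<close> of \<open>exp (F t)\<close>, where the equation \<open>\<Sum>j=1..r. x ^ j = n\<close> makes the linear term of \<open>F\<close>
at \<open>0\<close> vanish:
\<open>F t = (\<Sum>j=1..r. x ^ j / j * (exp (\<i> j t) - 1 - \<i> j t))\<close>  (\<open>nu_eq_saddle_integral\<close>).
Hence \<open>F t\<close> is close to \<open>- \<lambda> t^2 / 2\<close> with \<open>\<lambda> = (\<Sum>j=1..r. j x ^ j)\<close>, and \<open>r n / 2 \<le> \<lambda> \<le> r n\<close>.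

On the central arc \<open>\<bar>t\<bar> \<le> \<pi> / r\<close> the cubic term of \<open>F\<close> is imaginary, so that it enters the real part
of the integrand only through its square; square and quartic term both contribute a relative error
\<open>O(r^2 / \<lambda>) = O(r / n)\<close>, with a Gaussian weight (\<open>central_estimate\<close>).

On the outer arc \<open>\<pi> / r \<le> \<bar>t\<bar> \<le> \<pi>\<close> one has \<open>- Re (F t) \<ge> (n - \<bar>\<Sum>j=1..r. z ^ j\<bar>) / r\<close> with
\<open>z = x exp (\<i> t)\<close>. The geometric sum is smaller than \<open>n\<close> by a factor that depends on
\<open>\<bar>z - 1\<bar> / (x - 1)\<close>, and since \<open>x - 1\<close> is at most of order \<open>ln (n / r) / r\<close> when \<open>x\<close> is bounded, this
gives \<open>- Re (F t)\<close> at least of order \<open>(n / r) / (ln (n / r))^2\<close>. This is where the hypothesis on \<open>r\<close>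
enters: it says that \<open>n / r\<close> is at least a large multiple of \<open>ln n (ln (ln n))^2\<close>, which makes the
decay at least \<open>2 ln n\<close> (\<open>outer_decay_rate\<close>). The outer arc then contributes only \<open>O(1 / n^2)\<close>, and
\<open>1 / n^2\<close> is at most \<open>r / n\<close> times the main term \<open>sqrt (2 \<pi> / \<lambda>)\<close>, up to a constant.

These estimates need \<open>n\<close> large. The remaining pairs \<open>(n, r)\<close> are finite in number and are absorbed
in the constant.
\<close>

section \<open>Counting permutations with short cycles\<close>

text \<open>
Composing with the transposition of a new point \<open>a\<close> and an old point \<open>b\<close> inserts \<open>a\<close> into the cycle of
\<open>b\<close>, directly before \<open>b\<close>, and leaves all other cycles alone.
\<close>

lemma orbit_transpose_comp:
  assumes S: "finite S" "a \<notin> S" and p: "p permutes S" and b: "b \<in> S"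
  shows "orbit (Transposition.transpose a b \<circ> p) a = insert a (orbit p b)"
    and "c \<in> S \<Longrightarrow> c \<notin> orbit p b \<Longrightarrow> orbit (Transposition.transpose a b \<circ> p) c = orbit p c"
proof -
  define q where "q = Transposition.transpose a b \<circ> p"
  have pS: "p y \<in> S" if "y \<in> S" for y
    using that p by (simp add: permutes_in_image)
  have pa: "p a = a"
    using p S(2) by (simp add: permutes_not_in)
  have qa: "q a = b"
    by (simp add: q_def pa)
  have q_eq: "q y = (if p y = b then a else p y)" if "y \<in> S" for y
    using pS[OF that] S(2) by (auto simp: q_def Transposition.transpose_def)
  have perm: "permutation p"
    using p S(1) by (auto simp: permutation_permutes)
  have sub: "orbit p c \<subseteq> S" if "c \<in> S" for c
    using permutes_orbit_subset[OF p that] .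
  have "q permutes insert a S"
    unfolding q_def
    by (intro permutes_compose[OF permutes_imp_permutes_insert[OF p]] permutes_swap_id) (use b in auto)
  then have "permutation q"
    using S(1) by (auto simp: permutation_permutes)
  then have self: "a \<in> orbit q a"
    by (rule permutation_self_in_orbit)
  show "orbit (Transposition.transpose a b \<circ> p) a = insert a (orbit p b)"
    unfolding q_def[symmetric]
  proof (intro equalityI subsetI)
    fix y assume "y \<in> orbit q a"
    then show "y \<in> insert a (orbit p b)"
    proof induction
      case base
      then show ?case using qa permutation_self_in_orbit[OF perm] by simp
    next
      case (step y)
      then show ?case
        using qa permutation_self_in_orbit[OF perm] q_eq[of y] sub[OF b] orbit.step[of y p b]
        by (auto split: if_splits)
    qed
  next
    fix y assume "y \<in> insert a (orbit p b)"
    moreover have bq: "b \<in> orbit q a"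
      using orbit.base[of q a] qa by simp
    moreover have "y \<in> orbit q a" if "y \<in> orbit p b"
      using that
    proof induction
      case base
      then show ?case using bq q_eq[OF b] orbit.step[OF bq] by (cases "p b = b") auto
    next
      case (step y)
      then show ?case
        using bq q_eq[of y] sub[OF b] orbit.step[OF step.IH] by (cases "p y = b") auto
    qed
    ultimately show "y \<in> orbit q a"
      using self by auto
  qed
  show "orbit (Transposition.transpose a b \<circ> p) c = orbit p c" if c: "c \<in> S" "c \<notin> orbit p b"
  proof (rule orbit_cong)
    show cc: "c \<in> orbit p c"
      by (rule permutation_self_in_orbit[OF perm])
    fix s assume s: "s \<in> orbit p c"
    then have "p s \<in> orbit p c"
      by (rule orbit.step)
    then have "p s \<noteq> b"
      using orbit_swap[OF cc] c(2) by auto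
    then show "(Transposition.transpose a b \<circ> p) s = p s"
      using q_eq[of s] sub[OF c(1)] s unfolding q_def by auto
  qed
qed

definition short_perms :: "nat \<Rightarrow> 'a set \<Rightarrow> ('a \<Rightarrow> 'a) set" where
  "short_perms r A = {\<sigma>. \<sigma> permutes A \<and> (\<forall>c\<in>A. card (orbit \<sigma> c) \<le> r)}"

text \<open>
The bound on the cycle of the marked point \<open>a\<close> is decoupled from the bound \<open>r\<close> on the others, because
removing \<open>a\<close> shortens its cycle by one; the family with varying \<open>k\<close> is closed under this step.
\<close>

definition marked_perms :: "nat \<Rightarrow> 'a set \<Rightarrow> 'a \<Rightarrow> nat \<Rightarrow> ('a \<Rightarrow> 'a) set" where
  "marked_perms r A a k = {\<sigma>. \<sigma> permutes A \<and> card (orbit \<sigma> a) \<le> k \<and>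
     (\<forall>c\<in>A - orbit \<sigma> a. card (orbit \<sigma> c) \<le> r)}"

lemma marked_perms_eq_short_perms:
  assumes "finite A" "a \<in> A"
  shows "marked_perms r A a r = short_perms r A"
proof -
  have "card (orbit \<sigma> c) = card (orbit \<sigma> a)" if "\<sigma> permutes A" "c \<in> orbit \<sigma> a" for \<sigma> c
    using orbit_cyclic_eq3[OF cyclic_on_orbit[OF that(1) assms(1)] that(2)] by simp
  then show ?thesis
    unfolding marked_perms_def short_perms_def using assms(2) by fastforce
qed

lemma transpose_comp_in_marked_perms_iff:
  assumes S: "finite S" "a \<notin> S" and p: "p permutes S" and b: "b \<in> insert a S"
  shows "Transposition.transpose a b \<circ> p \<in> marked_perms r (insert a S) a (Suc k) \<longleftrightarrow>
    p \<in> (if b = a then short_perms r S else marked_perms r S b k)"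
proof -
  have q: "Transposition.transpose a b \<circ> p permutes insert a S"
    by (intro permutes_compose[OF permutes_imp_permutes_insert[OF p]] permutes_swap_id) (use b in auto)
  show ?thesis
  proof (cases "b = a")
    case True
    have "orbit p a = {a}"
      using p S(2) by (simp add: orbit_eq_singleton_iff permutes_not_in)
    then show ?thesis
      using True q p S(2) by (auto simp: marked_perms_def short_perms_def)
  next
    case False
    then have bS: "b \<in> S" using b by auto
    note orb = orbit_transpose_comp[OF S p bS]
    have sub: "orbit p b \<subseteq> S"
      using permutes_orbit_subset[OF p bS] .
    then have "card (insert a (orbit p b)) = Suc (card (orbit p b))"
      using S finite_subset by (subst card_insert_disjoint) auto
    moreover have "insert a S - insert a (orbit p b) = S - orbit p b"
      using S by auto
    ultimately show ?thesis
      using False q p orb by (auto simp: marked_perms_def)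
  qed
qed

text \<open>
A permutation of \<open>insert a S\<close> arises from exactly one permutation of \<open>S\<close>, either by adding \<open>a\<close> as a
fixed point or by inserting \<open>a\<close> before a point \<open>b\<close>; in the second case \<open>b\<close> becomes the marked point
of the smaller permutation.
\<close>

lemma card_marked_perms_insert:
  assumes S: "finite S" "a \<notin> S"
  shows "card (marked_perms r (insert a S) a (Suc k)) =
    card (short_perms r S) + (\<Sum>b\<in>S. card (marked_perms r S b k))"
proof -
  let ?f = "\<lambda>(b, p). Transposition.transpose a b \<circ> p"
  let ?T = "\<lambda>b. if b = a then short_perms r S else marked_perms r S b k"
  have T: "p permutes S" if "p \<in> ?T b" for p b
    using that by (auto simp: short_perms_def marked_perms_def split: if_splits)
  have fin: "finite (?T b)" for b
    using finite_permutations[OF S(1)] by (rule finite_subset[rotated]) (use T in blast)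
  have "marked_perms r (insert a S) a (Suc k) = ?f ` (SIGMA b:insert a S. ?T b)"
  proof (intro equalityI subsetI)
    fix \<sigma> assume s: "\<sigma> \<in> marked_perms r (insert a S) a (Suc k)"
    then have "\<sigma> \<in> {p. p permutes insert a S}"
      by (simp add: marked_perms_def)
    then obtain b p where bp: "\<sigma> = Transposition.transpose a b \<circ> p" "b \<in> insert a S" "p permutes S"
      unfolding permutes_insert by auto
    then have "p \<in> ?T b"
      using transpose_comp_in_marked_perms_iff[OF S bp(3,2)] s by blast
    then show "\<sigma> \<in> ?f ` (SIGMA b:insert a S. ?T b)"
      using bp by (intro image_eqI[of _ _ "(b, p)"]) auto
  next
    fix \<sigma> assume "\<sigma> \<in> ?f ` (SIGMA b:insert a S. ?T b)"
    then obtain b p where bp: "\<sigma> = Transposition.transpose a b \<circ> p" "b \<in> insert a S" "p \<in> ?T b"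
      by auto
    then show "\<sigma> \<in> marked_perms r (insert a S) a (Suc k)"
      using transpose_comp_in_marked_perms_iff[OF S T[OF bp(3)] bp(2)] by blast
  qed
  moreover have "inj_on ?f (SIGMA b:insert a S. ?T b)"
  proof (rule inj_onI, clarify)
    fix b p c q
    assume "p \<in> ?T b" "q \<in> ?T c" and eq: "Transposition.transpose a b \<circ> p = Transposition.transpose a c \<circ> q"
    then have "p a = a" "q a = a"
      using T S(2) by (blast intro: permutes_not_in)+
    then have "b = c"
      using fun_cong[OF eq, of a] by simp
    then have "Transposition.transpose a b \<circ> (Transposition.transpose a b \<circ> p) = Transposition.transpose a b \<circ> (Transposition.transpose a b \<circ> q)"
      using eq by simp
    then show "b = c \<and> p = q"
      using \<open>b = c\<close> by (simp add: fun_eq_iff)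
  qed
  ultimately have "card (marked_perms r (insert a S) a (Suc k)) = card (SIGMA b:insert a S. ?T b)"
    by (simp add: card_image)
  also have "\<dots> = (\<Sum>b\<in>insert a S. card (?T b))"
    using S fin by (intro card_SigmaI) auto
  also have "\<dots> = card (short_perms r S) + (\<Sum>b\<in>S. card (?T b))"
    using S by (subst sum.insert) auto
  also have "(\<Sum>b\<in>S. card (?T b)) = (\<Sum>b\<in>S. card (marked_perms r S b k))"
    using S(2) by (intro sum.cong) auto
  finally show ?thesis .
qed

text \<open>
The value for \<open>n = 0\<close> is the number of permutations of the empty set, which has no point to mark; it
makes \<open>marked_count r n r\<close> the number of permutations with all cycles of length at most \<open>r\<close> for every
\<open>n\<close>.
\<close>

fun marked_count :: "nat \<Rightarrow> nat \<Rightarrow> nat \<Rightarrow> nat" where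
  "marked_count r 0 k = 1"
| "marked_count r (Suc n) 0 = 0"
| "marked_count r (Suc n) (Suc k) = marked_count r n r + n * marked_count r n k"

lemma card_marked_perms:
  assumes "finite A"
  shows "a \<in> A \<Longrightarrow> card (marked_perms r A a k) = marked_count r (card A) k"
    and "card (short_perms r A) = marked_count r (card A) r"
  using assms
proof (induction "card A" arbitrary: A a k)
  case 0
  {
    case 1
    then show ?case using 0 by simp
  next
    case 2
    then have "short_perms r A = {id}"
      using 0 by (auto simp: short_perms_def)
    then show ?case using 2 0 by simp
  }
next
  case (Suc n)
  have marked: "card (marked_perms r A a k) = marked_count r (Suc n) k"
    if A: "a \<in> A" "finite A" "Suc n = card A" for A and a :: 'a and k
  proof (cases k)
    case 0
    have "card (orbit \<sigma> a) \<noteq> 0" if "\<sigma> permutes A" for \<sigma>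
      using finite_subset[OF permutes_orbit_subset[OF that A(1)] A(2)] orbit_nonempty[of \<sigma> a]
      by simp
    then have "marked_perms r A a k = {}"
      using 0 by (auto simp: marked_perms_def)
    then show ?thesis using 0 by simp
  next
    case (Suc j)
    define S where "S = A - {a}"
    have S: "finite S" "a \<notin> S" "insert a S = A" "n = card S"
      using A by (auto simp: S_def)
    show ?thesis
      using card_marked_perms_insert[OF S(1,2), of r j] Suc.hyps(1)[OF S(4) _ S(1)]
        Suc.hyps(2) S Suc by (simp add: Suc.hyps)
  qed
  {
    case 1
    then show ?case using marked Suc.hyps by simp
  next
    case 2
    then obtain a where "a \<in> A"
      using Suc.hyps by fastforce
    then show ?case
      using marked[of a A r] 2 Suc.hyps marked_perms_eq_short_perms[of A a r] by simp
  }
qed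

lemma nu_eq_marked_count: "nu n r = marked_count r n r / fact n"
proof -
  have "(\<forall>j\<in>{r+1..n}. num_cycles n \<sigma> j = 0) \<longleftrightarrow> (\<forall>c\<in>{1..n}. card (orbit \<sigma> c) \<le> r)"
    if "\<sigma> permutes {1..n}" for \<sigma>
  proof -
    have le: "card (orbit \<sigma> c) \<le> n" if "c \<in> {1..n}" for c
      using card_mono[OF _ permutes_orbit_subset[OF \<open>\<sigma> permutes {1..n}\<close> that]] by simp
    have "num_cycles n \<sigma> j = 0 \<longleftrightarrow> (\<forall>c\<in>{1..n}. card (orbit \<sigma> c) \<noteq> j)" for j
      by (auto simp: num_cycles_def)
    then have "(\<forall>j\<in>{r+1..n}. num_cycles n \<sigma> j = 0) \<longleftrightarrow>
        (\<forall>c\<in>{1..n}. \<forall>j\<in>{r+1..n}. card (orbit \<sigma> c) \<noteq> j)"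
      by blast
    also have "\<dots> \<longleftrightarrow> (\<forall>c\<in>{1..n}. card (orbit \<sigma> c) \<le> r)"
      using le by (intro ball_cong refl) (metis Suc_eq_plus1 atLeastAtMost_iff not_less_eq_eq)
    finally show ?thesis .
  qed
  then have "{\<sigma>. \<sigma> permutes {1..n} \<and> (\<forall>j\<in>{r+1..n}. num_cycles n \<sigma> j = 0)} = short_perms r {1..n}"
    by (auto simp: short_perms_def)
  then show ?thesis
    using card_marked_perms(2)[of "{1..n}" r] by (simp add: nu_def)
qed

lemma nu_0: "nu 0 r = 1"
  by (simp add: nu_eq_marked_count)

text \<open>
Unrolling the recursion for the marked cycle sums over its length \<open>i + 1\<close>. In terms of generating
functions, the identity says that the derivative of \<open>\<Sum>n. \<nu>(n, r) z ^ n\<close> is the series itself times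
\<open>1 + z + \<dots> + z ^ (r - 1)\<close>.
\<close>

lemma nu_Suc: "real (Suc n) * nu (Suc n) r = (\<Sum>i\<in>{i. i < r \<and> i \<le> n}. nu (n - i) r)"
proof -
  have "marked_count r (Suc n) k / fact n = (\<Sum>i\<in>{i. i < k \<and> i \<le> n}. nu (n - i) r)" for k
  proof (induction n arbitrary: k)
    case 0
    then show ?case
    proof (cases k)
      case (Suc j)
      then have "{i. i < k \<and> i \<le> 0} = {0::nat}" by auto
      then show ?thesis using Suc by (simp add: nu_0)
    qed simp
  next
    case (Suc n)
    show ?case
    proof (cases k)
      case (Suc j)
      have "{i. i < k \<and> i \<le> Suc n} = insert 0 (Suc ` {i. i < j \<and> i \<le> n})"
        unfolding Suc by (auto simp: image_iff) (metis Suc_le_mono Suc_less_eq not0_implies_Suc)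
      then have "(\<Sum>i\<in>{i. i < k \<and> i \<le> Suc n}. nu (Suc n - i) r) =
          nu (Suc n) r + (\<Sum>i\<in>{i. i < j \<and> i \<le> n}. nu (n - i) r)"
        by (simp add: sum.reindex)
      also have "\<dots> = nu (Suc n) r + marked_count r (Suc n) j / fact n"
        by (simp only: Suc.IH)
      also have "\<dots> = marked_count r (Suc (Suc n)) k / fact (Suc n)"
        unfolding nu_eq_marked_count Suc by (simp add: divide_simps) (simp add: algebra_simps)
      finally show ?thesis by simp
    qed simp
  qed
  from this[of r] show ?thesis
    unfolding nu_eq_marked_count[of "Suc n"] by simp
qed


section \<open>The integral representation\<close>

lemma higher_deriv_geometric_sum_0:
  "(deriv ^^ i) (\<lambda>z::complex. \<Sum>k<r. z ^ k) 0 = (if i < r then fact i else 0)"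
proof (induction r)
  case (Suc r)
  have "(deriv ^^ i) (\<lambda>z::complex. (\<Sum>k<r. z ^ k) + (z - 0) ^ r) 0 =
      (deriv ^^ i) (\<lambda>z. \<Sum>k<r. z ^ k) 0 + (deriv ^^ i) (\<lambda>z. (z - 0) ^ r) 0"
    by (rule higher_deriv_add[of _ UNIV]) (auto intro!: holomorphic_intros)
  also have "(deriv ^^ i) (\<lambda>z::complex. (z - 0) ^ r) 0 = (if i = r then fact i else 0)"
    unfolding higher_deriv_power
    by (cases i r rule: linorder_cases) (auto simp: pochhammer_fact pochhammer_0_left)
  finally show ?case
    using Suc.IH by auto
qed simp

definition cycle_egf :: "nat \<Rightarrow> complex \<Rightarrow> complex" where
  "cycle_egf r z = exp (\<Sum>j=1..r. z ^ j / of_nat j)"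

lemma holomorphic_cycle_egf: "cycle_egf r holomorphic_on A"
  unfolding cycle_egf_def by (intro holomorphic_intros) auto

lemma deriv_cycle_egf: "deriv (cycle_egf r) = (\<lambda>z. (\<Sum>k<r. z ^ k) * cycle_egf r z)"
proof
  fix z :: complex
  have "((\<lambda>z. \<Sum>j=1..r. z ^ j / of_nat j) has_field_derivative (\<Sum>j=1..r. z ^ (j - 1))) (at z)"
    by (auto intro!: derivative_eq_intros sum.cong)
  moreover have "(\<Sum>j=1..r. z ^ (j - 1)) = (\<Sum>k<r. z ^ k)"
    by (rule sum.reindex_bij_witness[of _ Suc "\<lambda>j. j - 1"]) auto
  ultimately have "(cycle_egf r has_field_derivative ((\<Sum>k<r. z ^ k) * cycle_egf r z)) (at z)"
    unfolding cycle_egf_def by (auto intro!: derivative_eq_intros)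
  then show "deriv (cycle_egf r) z = (\<Sum>k<r. z ^ k) * cycle_egf r z"
    by (rule DERIV_imp_deriv)
qed

text \<open>
By the Leibniz rule the Taylor coefficients of the solution of \<open>f' = (1 + z + \<dots> + z ^ (r - 1)) f\<close>
with \<open>f 0 = 1\<close> satisfy the recursion \<open>nu_Suc\<close>.
\<close>

lemma higher_deriv_cycle_egf_0: "(deriv ^^ n) (cycle_egf r) 0 = of_real (fact n * nu n r)"
proof (induction n rule: less_induct)
  case (less n)
  show ?case
  proof (cases n)
    case 0
    have "(\<Sum>j=1..r. (0::complex) ^ j / of_nat j) = 0"
      by (intro sum.neutral) auto
    then show ?thesis
      using 0 by (simp add: cycle_egf_def nu_0)
  next
    case (Suc m)
    have "(deriv ^^ n) (cycle_egf r) 0 = (deriv ^^ m) (\<lambda>z. (\<Sum>k<r. z ^ k) * cycle_egf r z) 0"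
      unfolding Suc funpow_Suc_right o_def deriv_cycle_egf ..
    also have "\<dots> = (\<Sum>i = 0..m. of_nat (m choose i) * (deriv ^^ i) (\<lambda>z. \<Sum>k<r. z ^ k) 0 *
        (deriv ^^ (m - i)) (cycle_egf r) 0)"
      by (rule higher_deriv_mult[of _ UNIV]) (auto intro!: holomorphic_intros holomorphic_cycle_egf)
    also have "\<dots> = (\<Sum>i = 0..m. if i < r then of_real (fact m * nu (m - i) r) else 0)"
    proof (intro sum.cong refl)
      fix i assume i: "i \<in> {0..m}"
      have "complex_of_real (fact m) = of_nat (m choose i) * fact i * fact (m - i)"
        using i binomial_fact_lemma[of i m] by (metis (no_types, lifting) atLeastAtMost_iff mult.commute mult.left_commute of_nat_fact of_nat_mult of_real_fact)
      then show "of_nat (m choose i) * (deriv ^^ i) (\<lambda>z. \<Sum>k<r. z ^ k) 0 *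
          (deriv ^^ (m - i)) (cycle_egf r) 0 = (if i < r then complex_of_real (fact m * nu (m - i) r) else 0)"
        using less.IH[of "m - i"] Suc by (simp add: higher_deriv_geometric_sum_0)
    qed
    also have "\<dots> = (\<Sum>i\<in>{i. i < r \<and> i \<le> m}. of_real (fact m * nu (m - i) r))"
      by (subst sum.inter_filter[symmetric]) (auto intro!: sum.cong)
    also have "\<dots> = of_real (fact m * (\<Sum>i\<in>{i. i < r \<and> i \<le> m}. nu (m - i) r))"
      by (simp add: sum_distrib_left)
    also have "\<dots> = of_real (fact n * nu n r)"
      unfolding nu_Suc[symmetric] Suc by (simp add: algebra_simps)
    finally show ?thesis .
  qed
qed

text \<open>
The integral over the circle comes as one over \<open>[0, 2 \<pi>]\<close>, whereas the saddle point \<open>t = 0\<close>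
should be interior to the interval.
\<close>

lemma integral_period_shift:
  fixes f :: "real \<Rightarrow> 'a::banach"
  assumes cont: "continuous_on UNIV f" and per: "\<And>t. f (t + 2 * pi) = f t"
  shows "integral {0..2 * pi} f = integral {-pi..pi} f"
proof -
  have int: "f integrable_on {a..b}" for a b
    by (intro integrable_continuous_real continuous_on_subset[OF cont]) auto
  have "integral {pi..2 * pi} f = integral {- pi..0} f"
    using integral_shift_Icc_real[of "- pi" 0 f "2 * pi"] per by (simp add: o_def add.commute)
  moreover have "integral {0..pi} f + integral {pi..2 * pi} f = integral {0..2 * pi} f"
    by (rule Henstock_Kurzweil_Integration.integral_combine) (auto simp: int)
  moreover have "integral {- pi..0} f + integral {0..pi} f = integral {- pi..pi} f"
    by (rule Henstock_Kurzweil_Integration.integral_combine) (auto simp: int)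
  ultimately show ?thesis by (metis add.commute)
qed

lemma nu_eq_integral:
  assumes x: "0 < x"
  shows "complex_of_real (nu n r) = 1 / (2 * pi * x ^ n) *
    integral {-pi..pi} (\<lambda>t. cycle_egf r (x * cis t) * cis (- (real n * t)))"
proof -
  have "(deriv ^^ n) (cycle_egf r) 0 = fact n / (2 * pi * \<i>) *
      contour_integral (circlepath 0 x) (\<lambda>u. cycle_egf r u / (u - 0) ^ Suc n)"
    by (rule Cauchy_higher_derivative_integral_circlepath)
       (use x in \<open>auto intro!: holomorphic_cycle_egf holomorphic_on_imp_continuous_on\<close>)
  then have "complex_of_real (nu n r) = 1 / (2 * pi * \<i>) *
      contour_integral (circlepath 0 x) (\<lambda>u. cycle_egf r u / u ^ Suc n)"
    unfolding higher_deriv_cycle_egf_0 by (simp add: field_simps)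
  also have "contour_integral (circlepath 0 x) (\<lambda>u. cycle_egf r u / u ^ Suc n) =
      integral {0..2 * pi} (\<lambda>t. cycle_egf r (0 + x * cis t) / (0 + x * cis t) ^ Suc n * x * \<i> * cis t)"
    unfolding circlepath_def by (rule contour_integral_part_circlepath_eq) simp
  also have "(\<lambda>t. cycle_egf r (0 + x * cis t) / (0 + x * cis t) ^ Suc n * x * \<i> * cis t) =
      (\<lambda>t. (\<i> / x ^ n) * (cycle_egf r (x * cis t) * cis (- (real n * t))))"
  proof
    fix t
    have "cis t ^ n * cis (- (real n * t)) = 1"
      unfolding Complex.DeMoivre cis_mult by simp
    then have "cis (- (real n * t)) = 1 / cis t ^ n"
      by (simp add: field_simps)
    then show "cycle_egf r (0 + x * cis t) / (0 + x * cis t) ^ Suc n * x * \<i> * cis t =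
        (\<i> / x ^ n) * (cycle_egf r (x * cis t) * cis (- (real n * t)))"
      using x by (simp add: field_simps power_mult_distrib)
  qed
  also have "integral {0..2 * pi} (\<lambda>t. (\<i> / x ^ n) * (cycle_egf r (x * cis t) * cis (- (real n * t)))) =
      (\<i> / x ^ n) * integral {0..2 * pi} (\<lambda>t. cycle_egf r (x * cis t) * cis (- (real n * t)))"
    by simp
  also have "integral {0..2 * pi} (\<lambda>t. cycle_egf r (x * cis t) * cis (- (real n * t))) =
      integral {-pi..pi} (\<lambda>t. cycle_egf r (x * cis t) * cis (- (real n * t)))"
  proof (rule integral_period_shift)
    have "continuous_on UNIV (cycle_egf r)"
      by (intro holomorphic_on_imp_continuous_on holomorphic_cycle_egf)
    then have "continuous_on UNIV (\<lambda>t. cycle_egf r (x * cis t))"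
      by (rule continuous_on_compose2) (auto intro!: continuous_intros)
    then show "continuous_on UNIV (\<lambda>t. cycle_egf r (x * cis t) * cis (- (real n * t)))"
      by (rule continuous_on_mult) (intro continuous_intros)
    have cis_shift: "cis (t + 2 * pi) = cis t" for t
      by (simp add: complex_eq_iff)
    have period: "cis (- (real n * (t + 2 * pi))) = cis (- (real n * t))" for t
    proof -
      have "cis (- (real n * (t + 2 * pi))) = cis (- (real n * t)) * inverse (cis (2 * pi) ^ n)"
        by (simp only: Complex.DeMoivre cis_inverse cis_mult) (simp add: algebra_simps)
      then show ?thesis by simp
    qed
    then show "cycle_egf r (x * cis (t + 2 * pi)) * cis (- (real n * (t + 2 * pi))) =
        cycle_egf r (x * cis t) * cis (- (real n * t))" for t
      by (simp only: cis_shift period)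
  qed
  finally show ?thesis
    using x by (simp add: field_simps)
qed

text \<open>
This is the exponent \<open>F\<close> of the overview.
\<close>

definition saddle_exponent :: "nat \<Rightarrow> real \<Rightarrow> real \<Rightarrow> complex" where
  "saddle_exponent r x t = (\<Sum>j=1..r. (x ^ j / real j) * (cis (real j * t) - 1 - \<i> * (real j * t)))"

lemma continuous_on_saddle_exponent [continuous_intros]: "continuous_on A (saddle_exponent r x)"
  unfolding saddle_exponent_def by (intro continuous_intros)

text \<open>
The factor \<open>exp (- \<i> n t)\<close> from \<open>z ^ (- n)\<close> is distributed over the sum by writing \<open>n\<close> as
\<open>\<Sum>j=1..r. x ^ j\<close>; it cancels the first order terms.
\<close>

lemma nu_eq_saddle_integral:
  assumes x: "0 < x" and n: "(\<Sum>j=1..r. x ^ j) = real n"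
  shows "nu n r = exp (\<Sum>j=1..r. x ^ j / real j) / (2 * pi * x ^ n) *
    integral {-pi..pi} (\<lambda>t. Re (exp (saddle_exponent r x t)))"
proof -
  let ?c = "exp (\<Sum>j=1..r. x ^ j / real j)"
  let ?I = "integral {-pi..pi} (\<lambda>t. exp (saddle_exponent r x t))"
  have "cycle_egf r (x * cis t) * cis (- (real n * t)) = ?c * exp (saddle_exponent r x t)" for t
  proof -
    have "complex_of_real (real n * t) = (\<Sum>j=1..r. (x ^ j / real j) * (real j * t))"
      unfolding n[symmetric] sum_distrib_right of_real_sum by (intro sum.cong) auto
    moreover have "complex_of_real (x ^ j / real j) * (cis (real j * t) - 1 - \<i> * (real j * t)) =
        (x * cis t) ^ j / of_nat j - complex_of_real (x ^ j / real j) - \<i> * ((x ^ j / real j) * (real j * t))" for j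
      by (simp add: ring_distribs power_mult_distrib diff_divide_distrib flip: Complex.DeMoivre)
    ultimately have "saddle_exponent r x t =
      (\<Sum>j=1..r. (x * cis t) ^ j / of_nat j) - complex_of_real (\<Sum>j=1..r. x ^ j / real j) - \<i> * (real n * t)"
      by (simp only: saddle_exponent_def sum_subtractf of_real_sum sum_distrib_left)
    then have "(\<Sum>j=1..r. (x * cis t) ^ j / of_nat j) + \<i> * complex_of_real (- (real n * t)) =
      complex_of_real (\<Sum>j=1..r. x ^ j / real j) + saddle_exponent r x t"
      by (simp only: of_real_minus) (simp add: algebra_simps)
    then show ?thesis
      unfolding cycle_egf_def cis_conv_exp[of "- (real n * t)"] exp_of_real[symmetric] exp_add[symmetric]
      by (simp only:)
  qed
  then have "complex_of_real (nu n r) = complex_of_real (?c / (2 * pi * x ^ n)) * ?I"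
    unfolding nu_eq_integral[OF x] by simp
  then have "nu n r = Re (complex_of_real (?c / (2 * pi * x ^ n)) * ?I)"
    by (metis Re_complex_of_real)
  also have "\<dots> = ?c / (2 * pi * x ^ n) * Re ?I"
    unfolding times_complex.sel Re_complex_of_real Im_complex_of_real by simp
  also have "Re ?I = integral {-pi..pi} (\<lambda>t. Re (exp (saddle_exponent r x t)))"
    using integral_linear[OF integrable_continuous_real bounded_linear_Re, of "-pi" pi
        "\<lambda>t. exp (saddle_exponent r x t)"]
    by (simp add: o_def continuous_intros)
  finally show ?thesis .
qed


section \<open>Size of the variance\<close>

text \<open>
If \<open>x ^ j / j\<close> are the intensities of independent Poisson variables \<open>K j\<close>, then this is the variance \<open>\<lambda>\<close>
of \<open>\<Sum>j=1..r. j K j\<close>.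
\<close>

definition saddle_variance :: "nat \<Rightarrow> real \<Rightarrow> real" where
  "saddle_variance r x = (\<Sum>j=1..r. real j * x ^ j)"

lemma saddle_variance_le:
  assumes "0 \<le> x"
  shows "saddle_variance r x \<le> real r * (\<Sum>j=1..r. x ^ j)"
  unfolding saddle_variance_def sum_distrib_left
  using assms by (intro sum_mono mult_right_mono) auto

text \<open>
For \<open>x \<ge> 1\<close> the weights \<open>x ^ j\<close> increase with \<open>j\<close>, so their centre of mass is at least \<open>(r + 1) / 2\<close>.
The proof pairs \<open>j\<close> with \<open>r + 1 - j\<close>.
\<close>

lemma saddle_variance_ge:
  assumes x: "1 \<le> x"
  shows "real (r + 1) / 2 * (\<Sum>j=1..r. x ^ j) \<le> saddle_variance r x"
proof -
  let ?d = "\<lambda>j. 2 * real j - real (r + 1)"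
  have rev: "(\<Sum>j=1..r. ?d j * x ^ j) = (\<Sum>j=1..r. ?d (r + 1 - j) * x ^ (r + 1 - j))"
    by (subst sum.atLeastAtMost_rev) simp
  have "(\<Sum>j=1..r. ?d (r + 1 - j) * x ^ (r + 1 - j)) = - (\<Sum>j=1..r. ?d j * x ^ (r + 1 - j))"
    unfolding sum_negf[symmetric] by (intro sum.cong refl) (auto simp: of_nat_diff algebra_simps)
  then have "2 * (\<Sum>j=1..r. ?d j * x ^ j) = (\<Sum>j=1..r. ?d j * (x ^ j - x ^ (r + 1 - j)))"
    using rev unfolding right_diff_distrib sum_subtractf by linarith
  also have "\<dots> \<ge> 0"
  proof (rule sum_nonneg)
    fix j assume "j \<in> {1..r}"
    show "0 \<le> ?d j * (x ^ j - x ^ (r + 1 - j))"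
    proof (cases "r + 1 - j \<le> j")
      case True
      then show ?thesis
        using power_increasing[OF True x] by (intro mult_nonneg_nonneg) auto
    next
      case False
      then show ?thesis
        using power_increasing[of j "r + 1 - j" x] x by (intro mult_nonpos_nonpos) auto
    qed
  qed
  finally have "0 \<le> (\<Sum>j=1..r. ?d j * x ^ j)" by simp
  also have "\<dots> = 2 * saddle_variance r x - real (r + 1) * (\<Sum>j=1..r. x ^ j)"
    by (simp add: saddle_variance_def left_diff_distrib sum_subtractf sum_distrib_left mult.assoc)
  finally show ?thesis by simp
qed

section \<open>The central arc\<close>

lemma norm_cis_minus_quadratic_le: "norm (cis u - 1 - \<i> * u + u ^ 2 / 2) \<le> \<bar>u\<bar> ^ 3 / 6"
proof -
  have "cis u - 1 - \<i> * u + u ^ 2 / 2 = exp (\<i> * u) - (\<Sum>k\<le>2. (\<i> * u) ^ k / fact k)"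
    by (simp add: cis_conv_exp eval_nat_numeral field_simps)
  then have "norm (cis u - 1 - \<i> * u + u ^ 2 / 2) \<le> \<bar>u\<bar> ^ Suc 2 / fact (Suc 2)"
    using iexp_approx1[of u 2] by (simp only:)
  then show ?thesis
    by (simp add: eval_nat_numeral)
qed

lemma abs_cos_minus_quadratic_le: "\<bar>cos u - 1 + u ^ 2 / 2\<bar> \<le> u ^ 4 / 24" for u :: real
proof -
  have "cos u - 1 + u ^ 2 / 2 = Re (exp (\<i> * u) - (\<Sum>k\<le>3. (\<i> * u) ^ k / fact k))"
    by (simp add: cis_conv_exp[symmetric] eval_nat_numeral field_simps)
  then have "\<bar>cos u - 1 + u ^ 2 / 2\<bar> \<le> \<bar>u\<bar> ^ Suc 3 / fact (Suc 3)"
    using order.trans[OF abs_Re_le_cmod iexp_approx1[of u 3]] by (simp only:)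
  then show ?thesis
    by (simp add: eval_nat_numeral)
qed

text \<open>
The Taylor bound \<open>1 - cos u \<ge> u^2 / 2 - u^4 / 24\<close> suffices on all of \<open>[-\<pi>, \<pi>]\<close> because \<open>\<pi>^2 \<le> 10\<close>.
\<close>

lemma one_minus_cos_ge:
  fixes u :: real
  assumes "\<bar>u\<bar> \<le> pi"
  shows "u ^ 2 / 12 \<le> 1 - cos u"
proof -
  have "u ^ 2 \<le> pi ^ 2"
    using power_mono[OF assms, of 2] by simp
  also have "pi ^ 2 \<le> 3.15 ^ 2"
    using pi_approx by (intro power_mono) auto
  also have "\<dots> \<le> (10 :: real)"
    by (simp add: power2_eq_square)
  finally have "u ^ 2 * u ^ 2 \<le> u ^ 2 * 10"
    by (intro mult_left_mono) auto
  then have "u ^ 4 \<le> 10 * u ^ 2"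
    by (simp add: eval_nat_numeral)
  then show ?thesis
    using abs_cos_minus_quadratic_le[of u] unfolding abs_le_iff by simp
qed

lemma norm_saddle_exponent_le:
  assumes x: "0 \<le> x"
  shows "norm (saddle_exponent r x t + saddle_variance r x * t ^ 2 / 2) \<le>
    real r * saddle_variance r x * \<bar>t\<bar> ^ 3 / 6"
proof -
  have eq: "saddle_exponent r x t + saddle_variance r x * t ^ 2 / 2 =
      (\<Sum>j=1..r. (x ^ j / real j) * (cis (real j * t) - 1 - \<i> * (real j * t) + (real j * t) ^ 2 / 2))"
    unfolding saddle_exponent_def saddle_variance_def
    unfolding distrib_left sum.distrib by (simp add: sum_distrib_left sum_distrib_right sum_divide_distrib power2_eq_square mult_ac)
  show ?thesis
    unfolding eq unfolding saddle_variance_def sum_distrib_left sum_distrib_right sum_divide_distrib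
  proof (rule sum_norm_le)
    fix j assume j: "j \<in> {1..r}"
    have "norm ((x ^ j / real j) * (cis (real j * t) - 1 - \<i> * (real j * t) + (real j * t) ^ 2 / 2)) =
        (x ^ j / real j) * norm (cis (real j * t) - 1 - \<i> * (real j * t) + (real j * t) ^ 2 / 2)"
      using x by (simp add: norm_mult norm_divide norm_power)
    also have "\<dots> \<le> (x ^ j / real j) * (\<bar>real j * t\<bar> ^ 3 / 6)"
      using x norm_cis_minus_quadratic_le[of "real j * t"] by (intro mult_left_mono) auto
    also have "\<dots> = real j * (real j * x ^ j) * \<bar>t\<bar> ^ 3 / 6"
      using j by (simp add: abs_mult power_mult_distrib eval_nat_numeral)
    also have "\<dots> \<le> real r * (real j * x ^ j) * \<bar>t\<bar> ^ 3 / 6"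
      using x j by (intro divide_right_mono mult_right_mono) auto
    finally show "norm ((x ^ j / real j) * (cis (real j * t) - 1 - \<i> * (real j * t) + (real j * t) ^ 2 / 2)) \<le>
        real r * (real j * x ^ j) * \<bar>t\<bar> ^ 3 / 6" .
  qed
qed

lemma Re_saddle_exponent: "Re (saddle_exponent r x t) = (\<Sum>j=1..r. x ^ j / real j * (cos (real j * t) - 1))"
  by (simp add: saddle_exponent_def)

text \<open>
The real part of the exponent has no cubic term.
\<close>

lemma abs_Re_saddle_exponent_le:
  assumes x: "0 \<le> x"
  shows "\<bar>Re (saddle_exponent r x t) + saddle_variance r x * t ^ 2 / 2\<bar> \<le>
    real r ^ 2 * saddle_variance r x * t ^ 4 / 24"
proof -
  have eq: "Re (saddle_exponent r x t) + saddle_variance r x * t ^ 2 / 2 =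
      (\<Sum>j=1..r. (x ^ j / real j) * (cos (real j * t) - 1 + (real j * t) ^ 2 / 2))"
    unfolding Re_saddle_exponent saddle_variance_def
    unfolding distrib_left sum.distrib by (simp add: sum_distrib_left sum_distrib_right sum_divide_distrib power2_eq_square mult_ac)
  show ?thesis
    unfolding eq unfolding saddle_variance_def sum_distrib_left sum_distrib_right sum_divide_distrib
  proof (rule order.trans[OF sum_abs sum_mono])
    fix j assume j: "j \<in> {1..r}"
    have "\<bar>(x ^ j / real j) * (cos (real j * t) - 1 + (real j * t) ^ 2 / 2)\<bar> =
        (x ^ j / real j) * \<bar>cos (real j * t) - 1 + (real j * t) ^ 2 / 2\<bar>"
      using x by (simp add: abs_mult)
    also have "\<dots> \<le> (x ^ j / real j) * ((real j * t) ^ 4 / 24)"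
      using x abs_cos_minus_quadratic_le[of "real j * t"] by (intro mult_left_mono) auto
    also have "\<dots> = real j ^ 2 * (real j * x ^ j) * t ^ 4 / 24"
      using j by (simp add: power_mult_distrib eval_nat_numeral)
    also have "\<dots> \<le> real r ^ 2 * (real j * x ^ j) * t ^ 4 / 24"
      using x j by (intro divide_right_mono mult_right_mono power_mono) auto
    finally show "\<bar>(x ^ j / real j) * (cos (real j * t) - 1 + (real j * t) ^ 2 / 2)\<bar> \<le>
        real r ^ 2 * (real j * x ^ j) * t ^ 4 / 24" .
  qed
qed

text \<open>
In the expansion \<open>exp w = 1 + w + O(\<bar>w\<bar>^2)\<close> the linear term is kept apart: when \<open>w\<close> is nearly
imaginary, its real part \<open>d\<close> is of the same small order as \<open>\<bar>w\<bar>^2\<close>.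
\<close>

lemma abs_Re_exp_perturbation_le:
  fixes w :: complex and u d :: real
  assumes "\<bar>Re w\<bar> \<le> d" and "norm w \<le> D"
  shows "\<bar>Re (exp (w - u)) - exp (- u)\<bar> \<le> exp (d - u) * (d + D ^ 2)"
proof -
  have d: "0 \<le> d" using assms(1) by linarith
  have "Re (exp (w - u)) - exp (- u) = exp (- u) * (Re w + Re (exp w - (1 + w)))"
  proof -
    have "exp (w - u) = complex_of_real (exp (- u)) * exp w"
      by (simp add: exp_diff exp_minus field_simps flip: exp_of_real)
    then show ?thesis
      by (simp add: algebra_simps)
  qed
  also have "\<bar>\<dots>\<bar> = exp (- u) * \<bar>Re w + Re (exp w - (1 + w))\<bar>"
    by (simp add: abs_mult)
  also have "\<dots> \<le> exp (- u) * (exp d * d + exp d * D ^ 2)"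
  proof (rule mult_left_mono)
    have "norm (exp w - (1 + w)) \<le> exp \<bar>Re w\<bar> * norm w ^ 2"
      using Taylor_exp[of w 1] by (simp add: eval_nat_numeral)
    also have "\<dots> \<le> exp d * D ^ 2"
      using assms by (intro mult_mono power_mono) auto
    finally have "\<bar>Re (exp w - (1 + w))\<bar> \<le> exp d * D ^ 2"
      using abs_Re_le_cmod order.trans by blast
    moreover have "\<bar>Re w\<bar> \<le> exp d * d"
      using assms(1) d mult_right_mono[of 1 "exp d" d] by simp
    ultimately show "\<bar>Re w + Re (exp w - (1 + w))\<bar> \<le> exp d * d + exp d * D ^ 2"
      by linarith
  qed simp
  also have "\<dots> = exp (d - u) * (d + D ^ 2)"
    by (simp add: exp_diff exp_minus field_simps)
  finally show ?thesis .
qed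

lemma power_le_fact_mult_exp:
  fixes v :: real
  assumes "0 \<le> v"
  shows "v ^ k \<le> fact k * exp v"
proof -
  have "v ^ k /\<^sub>R fact k \<le> (\<Sum>n. v ^ n /\<^sub>R fact n)"
    using assms sum_le_suminf[OF summable_exp_generic, of "{k}" v] by simp
  then show ?thesis
    by (simp add: exp_def field_simps)
qed

text \<open>
With \<open>v = \<lambda> t^2 / 24\<close> the Gaussian is \<open>exp (- 12 v)\<close>. The restriction on \<open>t\<close> and \<open>\<pi>^2 \<le> 10\<close> bound the
real part of the perturbation by \<open>10 v\<close>, which leaves \<open>exp (- 2 v)\<close>; one factor \<open>exp v\<close> of this
absorbs the polynomial in \<open>v\<close>, and \<open>24 * 2! + 384 * 3! \<le> 2400\<close>.
\<close>

lemma central_estimate: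
  assumes x: "0 \<le> x" and lam: "0 < saddle_variance r x" and t: "real r * \<bar>t\<bar> \<le> pi"
  shows "\<bar>Re (exp (saddle_exponent r x t)) - exp (- (saddle_variance r x / 2 * t ^ 2))\<bar> \<le>
    2400 * (real r ^ 2 / saddle_variance r x) * exp (- (saddle_variance r x / 24 * t ^ 2))"
proof -
  define L where "L = saddle_variance r x"
  define v where "v = L * t ^ 2 / 24"
  define w where "w = saddle_exponent r x t + L * t ^ 2 / 2"
  have L: "0 < L" and v: "0 \<le> v"
    using lam by (auto simp: L_def v_def)
  have t2: "t ^ 2 = 24 * v / L"
    using L by (simp add: v_def)
  have re: "\<bar>Re w\<bar> \<le> real r ^ 2 * L * t ^ 4 / 24"
    using abs_Re_saddle_exponent_le[OF x, of r t] by (simp add: w_def L_def)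
  have "(real r * \<bar>t\<bar>) ^ 2 \<le> 3.15 ^ 2"
    using t pi_approx by (intro power_mono) auto
  also have "\<dots> \<le> (10 :: real)"
    by (simp add: power2_eq_square)
  finally have "v * (real r ^ 2 * t ^ 2) \<le> v * 10"
    using v by (intro mult_left_mono) (auto simp: power_mult_distrib)
  then have rate: "real r ^ 2 * L * t ^ 4 / 24 \<le> 10 * v"
    by (simp add: v_def eval_nat_numeral mult_ac)
  have "\<bar>Re (exp (saddle_exponent r x t)) - exp (- (L / 2 * t ^ 2))\<bar> \<le>
      exp (real r ^ 2 * L * t ^ 4 / 24 - 12 * v) *
      (real r ^ 2 * L * t ^ 4 / 24 + (real r * L * \<bar>t\<bar> ^ 3 / 6) ^ 2)"
    using abs_Re_exp_perturbation_le[OF re, of "real r * L * \<bar>t\<bar> ^ 3 / 6" "12 * v"]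
      norm_saddle_exponent_le[OF x, of r t]
    by (simp add: w_def L_def v_def)
  also have "\<dots> \<le> exp (- (2 * v)) * (real r ^ 2 * L * t ^ 4 / 24 + (real r * L * \<bar>t\<bar> ^ 3 / 6) ^ 2)"
    using rate L by (intro mult_right_mono) auto
  also have "real r ^ 2 * L * t ^ 4 / 24 + (real r * L * \<bar>t\<bar> ^ 3 / 6) ^ 2 =
      real r ^ 2 * L * (t ^ 2) ^ 2 / 24 + real r ^ 2 * L ^ 2 * (t ^ 2) ^ 3 / 36"
    by (simp add: power_mult_distrib power_divide flip: power_mult)
  also have "\<dots> = real r ^ 2 / L * (24 * v ^ 2 + 384 * v ^ 3)"
    unfolding t2 using L by (simp add: field_simps eval_nat_numeral)
  also have "\<dots> \<le> real r ^ 2 / L * (2400 * exp v)"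
  proof (rule mult_left_mono)
    have "v ^ 2 \<le> 2 * exp v" "v ^ 3 \<le> 6 * exp v"
      using power_le_fact_mult_exp[OF v, of 2] power_le_fact_mult_exp[OF v, of 3]
      by (simp_all add: fact_numeral)
    then show "24 * v ^ 2 + 384 * v ^ 3 \<le> 2400 * exp v"
      using exp_gt_zero[of v] by linarith
  qed (use L in simp)
  finally have "\<bar>Re (exp (saddle_exponent r x t)) - exp (- (L / 2 * t ^ 2))\<bar> \<le>
      exp (- (2 * v)) * (real r ^ 2 / L * (2400 * exp v))" by simp
  also have "\<dots> = 2400 * (real r ^ 2 / L) * exp (- (L / 24 * t ^ 2))"
    by (simp add: v_def mult_exp_exp mult_ac)
  finally show ?thesis
    unfolding L_def .
qed

text \<open>
Beyond the central arc the Gaussian itself is an error term. Since \<open>1 \<le> (r t)^2 = (r^2 / \<lambda>) * \<lambda> t^2\<close>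
there, it obeys the same bound as the difference on the central arc.
\<close>

lemma gaussian_tail_estimate:
  assumes L: "0 < L" and t: "pi \<le> real r * \<bar>t\<bar>"
  shows "exp (- (L / 2 * t ^ 2)) \<le> 2400 * (real r ^ 2 / L) * exp (- (L / 24 * t ^ 2))"
proof -
  define v where "v = L * t ^ 2 / 24"
  have v: "0 \<le> v"
    using L by (auto simp: v_def)
  have "1 ^ 2 \<le> (real r * \<bar>t\<bar>) ^ 2"
    using t pi_gt3 by (intro power_mono) auto
  also have "\<dots> = real r ^ 2 / L * (24 * v)"
    using L by (simp add: v_def power_mult_distrib)
  also have "\<dots> \<le> real r ^ 2 / L * (2400 * exp v)"
  proof (rule mult_left_mono)
    show "24 * v \<le> 2400 * exp v"
      using power_le_fact_mult_exp[OF v, of 1] exp_gt_zero[of v] unfolding power_one_right fact_1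
      by linarith
  qed (use L in simp)
  finally have "exp (- (12 * v)) * 1 \<le> exp (- (2 * v)) * (real r ^ 2 / L * (2400 * exp v))"
    using v by (intro mult_mono) auto
  also have "\<dots> = 2400 * (real r ^ 2 / L) * exp (- v)"
    by (simp add: mult_exp_exp mult_ac)
  finally show ?thesis
    by (simp add: v_def)
qed

lemma has_integral_gaussian:
  fixes a :: real
  assumes a: "0 < a"
  shows "((\<lambda>t. exp (- (a * t ^ 2))) has_integral sqrt (pi / a)) UNIV"
proof -
  define s where "s = sqrt (1 / (2 * a))"
  have s: "0 < s" "s ^ 2 = 1 / (2 * a)"
    using a by (auto simp: s_def)
  have "(normal_density 0 s has_integral 1) UNIV"
    using has_integral_integral_lborel[OF integrable_normal_density[OF s(1), of 0]]
      integral_normal_density[OF s(1), of 0] by simp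
  then have "((\<lambda>t. sqrt (pi / a) * normal_density 0 s t) has_integral sqrt (pi / a) * 1) UNIV"
    by (rule has_integral_mult_right)
  moreover have "sqrt (pi / a) * normal_density 0 s t = exp (- (a * t ^ 2))" for t
    using a by (simp add: normal_density_def s(2) real_sqrt_divide)
  ultimately show ?thesis by simp
qed

text \<open>
The integral over \<open>[-\<pi>, \<pi>]\<close> is compared with the Gaussian integral over the whole line, so that no
truncated Gaussian has to be evaluated.
\<close>

lemma integral_close_to_gaussian:
  fixes f :: "real \<Rightarrow> real"
  assumes cont: "continuous_on {-pi..pi} f" and L: "0 < L"
    and le: "\<And>t. \<bar>(if t \<in> {-pi..pi} then f t else 0) - exp (- (L / 2 * t ^ 2))\<bar> \<le>
      B * exp (- (L / 24 * t ^ 2)) + (if t \<in> {-pi..pi} then e else 0)"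
  shows "\<bar>integral {-pi..pi} f - sqrt (2 * pi / L)\<bar> \<le> B * sqrt (24 * pi / L) + 2 * pi * e"
proof -
  have f: "((\<lambda>t. if t \<in> {-pi..pi} then f t else 0) has_integral integral {-pi..pi} f) UNIV"
    unfolding has_integral_restrict_UNIV
    using integrable_integral[OF integrable_continuous_real[OF cont]] .
  have g: "((\<lambda>t. exp (- (L / 2 * t ^ 2))) has_integral sqrt (2 * pi / L)) UNIV"
    using has_integral_gaussian[of "L / 2"] L by (simp add: mult.commute)
  have h: "((\<lambda>t. B * exp (- (L / 24 * t ^ 2))) has_integral B * sqrt (24 * pi / L)) UNIV"
    using has_integral_mult_right[OF has_integral_gaussian[of "L / 24"], of B] L
    by (simp add: mult.commute)
  have "((\<lambda>t. e) has_integral 2 * pi * e) {-pi..pi}"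
    using has_integral_const_real[of e "-pi" pi] by simp
  then have e: "((\<lambda>t. if t \<in> {-pi..pi} then e else 0) has_integral 2 * pi * e) UNIV"
    unfolding has_integral_restrict_UNIV .
  show ?thesis
    using integral_norm_bound_integral[OF has_integral_integrable[OF has_integral_diff[OF f g]]
        has_integral_integrable[OF has_integral_add[OF h e]]] le
    unfolding integral_unique[OF has_integral_diff[OF f g]] integral_unique[OF has_integral_add[OF h e]]
    by simp
qed


section \<open>The outer arc\<close>

lemma one_div_sqrt_one_plus_le:
  fixes g :: real
  assumes "0 \<le> g" "g \<le> 1 / 2"
  shows "1 / sqrt (1 + g) \<le> 1 - g / 3"
proof -
  have "1 \<le> (1 - g / 3) ^ 2 * (1 + g)"
  proof -
    have "0 \<le> g * (1 / 3 - 5 / 9 * g)"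
      using assms by (intro mult_nonneg_nonneg) auto
    moreover have "0 \<le> g * g * g"
      using assms by simp
    moreover have "(1 - g / 3) ^ 2 * (1 + g) = 1 + g * (1 / 3 - 5 / 9 * g) + g * g * g / 9"
      by (simp add: power2_eq_square field_simps)
    ultimately show ?thesis
      by simp
  qed
  then have "1 \<le> sqrt ((1 - g / 3) ^ 2 * (1 + g))"
    by simp
  also have "\<dots> = (1 - g / 3) * sqrt (1 + g)"
    using assms by (simp add: real_sqrt_mult)
  finally show ?thesis
    using assms by (simp add: field_simps)
qed

text \<open>
All terms of \<open>Re (F t) = (\<Sum>j=1..r. x ^ j / j * (cos (j t) - 1))\<close> are nonpositive, so \<open>1 / j\<close> may be
replaced by \<open>1 / r\<close>; what remains is a geometric sum.
\<close>

lemma Re_saddle_exponent_le_deficit: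
  assumes r: "1 \<le> r" and x: "0 \<le> x"
  shows "Re (saddle_exponent r x t) \<le>
    (norm (\<Sum>j=1..r. (x * cis t) ^ j) - (\<Sum>j=1..r. x ^ j)) / r"
proof -
  have "Re (saddle_exponent r x t) \<le> (\<Sum>j=1..r. x ^ j / r * (cos (real j * t) - 1))"
    unfolding Re_saddle_exponent
  proof (rule sum_mono)
    fix j assume j: "j \<in> {1..r}"
    have "x ^ j / r \<le> x ^ j / j"
      using j x by (intro divide_left_mono) auto
    then show "x ^ j / j * (cos (real j * t) - 1) \<le> x ^ j / r * (cos (real j * t) - 1)"
      by (rule mult_right_mono_neg) simp
  qed
  also have "\<dots> = (Re (\<Sum>j=1..r. (x * cis t) ^ j) - (\<Sum>j=1..r. x ^ j)) / r"
  proof -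
    have "Re ((x * cis t) ^ j) = x ^ j * cos (real j * t)" for j
      by (simp add: power_mult_distrib Complex.DeMoivre flip: of_real_power)
    then show ?thesis
      by (simp add: sum_subtractf right_diff_distrib sum_divide_distrib diff_divide_distrib)
  qed
  also have "\<dots> \<le> (norm (\<Sum>j=1..r. (x * cis t) ^ j) - (\<Sum>j=1..r. x ^ j)) / r"
    by (intro divide_right_mono diff_right_mono complex_Re_le_cmod) simp
  finally show ?thesis .
qed

lemma geometric_sum_from_1:
  fixes z :: "'a :: comm_ring_1"
  shows "(\<Sum>j=1..r. z ^ j) * (z - 1) = z * (z ^ r - 1)"
  by (induction r) (auto simp: algebra_simps)

text \<open>
With \<open>z = x exp (\<i> t)\<close>, the numerator of the geometric sum grows by a factor of at most
\<open>(x ^ r + 1) / (x ^ r - 1)\<close> when \<open>x\<close> is replaced by \<open>z\<close>, and its denominator grows by \<open>sqrt (1 + g)\<close>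
because \<open>\<bar>z - 1\<bar>^2 = (x - 1)^2 + 2 x (1 - cos t)\<close>.
\<close>

lemma norm_geometric_sum_le:
  assumes x: "1 < x" and r: "1 \<le> r" and g: "0 \<le> g" "g \<le> 1 / 2"
    and dev: "g * (x - 1) ^ 2 \<le> 2 * x * (1 - cos t)"
  shows "norm (\<Sum>j=1..r. (x * cis t) ^ j) \<le>
    (\<Sum>j=1..r. x ^ j) * (1 + 2 / (x ^ r - 1)) * (1 - g / 3)"
proof -
  let ?z = "x * cis t"
  have xr: "1 < x ^ r"
    using x r by (intro one_less_power) auto
  have "(cmod (?z - 1)) ^ 2 = (x * cos t - 1) ^ 2 + (x * sin t) ^ 2"
    by (simp add: cmod_power2)
  also have "\<dots> = x ^ 2 * ((cos t) ^ 2 + (sin t) ^ 2) - 2 * x * cos t + 1"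
    by (simp only: power2_diff power_mult_distrib distrib_left) simp
  also have "(cos t) ^ 2 + (sin t) ^ 2 = 1"
    by simp
  also have "x ^ 2 * 1 - 2 * x * cos t + 1 = (x - 1) ^ 2 + 2 * x * (1 - cos t)"
    by (simp add: power2_diff right_diff_distrib)
  finally have "(cmod (?z - 1)) ^ 2 = (x - 1) ^ 2 + 2 * x * (1 - cos t)" .
  then have "(x - 1) ^ 2 * (1 + g) \<le> (cmod (?z - 1)) ^ 2"
    using dev by (simp add: algebra_simps)
  then have "sqrt ((x - 1) ^ 2 * (1 + g)) \<le> cmod (?z - 1)"
    using real_le_rsqrt real_sqrt_le_iff by (metis norm_ge_zero real_sqrt_unique real_sqrt_le_mono)
  then have z1: "(x - 1) * sqrt (1 + g) \<le> cmod (?z - 1)"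
    using x by (simp add: real_sqrt_mult)
  have pos: "0 < (x - 1) * sqrt (1 + g)"
    using x g by simp
  have "norm (\<Sum>j=1..r. ?z ^ j) * cmod (?z - 1) = cmod (?z * (?z ^ r - 1))"
    by (simp only: norm_mult[symmetric] geometric_sum_from_1)
  also have "\<dots> \<le> x * (x ^ r + 1)"
    unfolding norm_mult using x norm_triangle_ineq4[of "?z ^ r" 1]
    by (intro mult_mono) (auto simp: norm_mult norm_power)
  finally have "norm (\<Sum>j=1..r. ?z ^ j) * ((x - 1) * sqrt (1 + g)) \<le> x * (x ^ r + 1)"
    using mult_left_mono[OF z1, of "norm (\<Sum>j=1..r. ?z ^ j)"] by simp
  then have "norm (\<Sum>j=1..r. ?z ^ j) \<le> x * (x ^ r + 1) / ((x - 1) * sqrt (1 + g))"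
    using pos by (simp only: pos_le_divide_eq)
  also have "\<dots> = (x * (x ^ r - 1) / (x - 1)) * ((x ^ r + 1) / (x ^ r - 1)) * (1 / sqrt (1 + g))"
    using xr by simp
  also have "(x ^ r + 1) / (x ^ r - 1) = 1 + 2 / (x ^ r - 1)"
    using xr by (simp add: field_simps)
  also have "x * (x ^ r - 1) / (x - 1) = (\<Sum>j=1..r. x ^ j)"
    using x geometric_sum_from_1[of x r] by (simp add: field_simps)
  also have "(\<Sum>j=1..r. x ^ j) * (1 + 2 / (x ^ r - 1)) * (1 / sqrt (1 + g)) \<le>
      (\<Sum>j=1..r. x ^ j) * (1 + 2 / (x ^ r - 1)) * (1 - g / 3)"
    using x xr one_div_sqrt_one_plus_le[OF g] by (intro mult_left_mono mult_nonneg_nonneg sum_nonneg) auto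
  finally show ?thesis .
qed

text \<open>
For \<open>\<bar>t\<bar> \<ge> \<pi> / r\<close> the gain \<open>g\<close> can be taken as a multiple of \<open>x / (r (x - 1))^2\<close>, capped at \<open>1 / 2\<close>. The
factor \<open>1 + 2 / (x ^ r - 1)\<close> costs only a constant because \<open>x ^ r \<ge> n / r\<close>.
\<close>
lemma Re_saddle_exponent_outer_le:
  assumes x: "1 < x" and r: "1 \<le> r" and n: "(\<Sum>j=1..r. x ^ j) = n" and y: "2 * real r \<le> n"
    and t: "pi \<le> real r * \<bar>t\<bar>" "\<bar>t\<bar> \<le> pi"
  shows "Re (saddle_exponent r x t) \<le> 4 - n / r * (min (1 / 2) (3 * x / (2 * (real r * (x - 1)) ^ 2)) / 3)"
proof -
  define g where "g = min (1 / 2) (3 * x / (2 * (real r * (x - 1)) ^ 2))"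
  have g: "0 \<le> g" "g \<le> 1 / 2"
    using x by (auto simp: g_def)
  have "n \<le> (\<Sum>j=1..r. x ^ r)"
    unfolding n[symmetric] using x by (intro sum_mono power_increasing) auto
  then have yx: "n / r \<le> x ^ r"
    using r by (simp add: field_simps)
  have y2: "2 \<le> n / r"
    using y r by (simp add: field_simps)
  have "3 / r \<le> pi / r"
    using pi_gt3 by (intro divide_right_mono) auto
  also have "\<dots> \<le> \<bar>t\<bar>"
    using t(1) r by (simp add: field_simps)
  finally have "(3 / r) ^ 2 \<le> \<bar>t\<bar> ^ 2"
    by (intro power_mono) auto
  then have "9 / r ^ 2 / 12 \<le> t ^ 2 / 12"
    by (simp add: power_divide)
  also have "\<dots> \<le> 1 - cos t"
    using one_minus_cos_ge[OF t(2)] .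
  finally have cos: "3 / (4 * r ^ 2) \<le> 1 - cos t"
    by simp
  have "g * (x - 1) ^ 2 \<le> 3 * x / (2 * (real r * (x - 1)) ^ 2) * (x - 1) ^ 2"
    by (intro mult_right_mono) (auto simp: g_def)
  also have "\<dots> = 2 * x * (3 / (4 * r ^ 2))"
    using x by (simp add: power_mult_distrib)
  also have "\<dots> \<le> 2 * x * (1 - cos t)"
    using cos x by (intro mult_left_mono) auto
  finally have S: "norm (\<Sum>j=1..r. (x * cis t) ^ j) \<le> n * (1 + 2 / (x ^ r - 1)) * (1 - g / 3)"
    using norm_geometric_sum_le[OF x r g] unfolding n by simp
  have "0 \<le> n"
    using y by linarith
  have "Re (saddle_exponent r x t) \<le> (norm (\<Sum>j=1..r. (x * cis t) ^ j) - n) / r"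
    using Re_saddle_exponent_le_deficit[OF r, of x t] x n by simp
  also have "\<dots> \<le> (n * (1 + 2 / (x ^ r - 1)) * (1 - g / 3) - n) / r"
    using S by (intro divide_right_mono) auto
  also have "\<dots> = n / r * (2 / (x ^ r - 1)) * (1 - g / 3) - n / r * (g / 3)"
    by (simp add: diff_divide_distrib add_divide_distrib algebra_simps)
  also have "n / r * (2 / (x ^ r - 1)) * (1 - g / 3) \<le> 4 * 1"
  proof (rule mult_mono)
    have "n / r * (2 / (x ^ r - 1)) \<le> n / r * (2 / (n / r - 1))"
      using yx y2 \<open>0 \<le> n\<close> by (intro mult_left_mono divide_left_mono) auto
    also have "\<dots> \<le> 4"
    proof -
      have "Y * (2 / (Y - 1)) \<le> 4" if "2 \<le> Y" for Y :: real
        using that by (simp add: field_simps)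
      then show ?thesis
        using y2 by blast
    qed
    finally show "n / r * (2 / (x ^ r - 1)) \<le> 4" .
  qed (use g in auto)
  finally show ?thesis
    unfolding g_def by simp
qed


section \<open>Location of the saddle point\<close>

lemma four_times_plus_one_le_exp:
  fixes s :: real
  assumes "3 \<le> s"
  shows "4 * s + 1 \<le> exp s"
proof -
  have "13 \<le> exp (3 :: real)"
    using exp_lower_Taylor_quadratic[of "3::real"] exp_lower_Taylor_quadratic[of "3/2::real"]
      mult_mono[of "1 + 3/2 + (3/2)\<^sup>2/2" "exp (3/2::real)" "1 + 3/2 + (3/2)\<^sup>2/2" "exp (3/2::real)"]
    by (simp add: power2_eq_square mult_exp_exp)
  then have "13 * (1 + (s - 3)) \<le> exp 3 * exp (s - 3)"
    using assms exp_ge_add_one_self[of "s - 3"] by (intro mult_mono) auto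
  then show ?thesis
    using assms by (simp add: mult_exp_exp)
qed

lemma one_minus_inverse_le_ln: "1 - 1 / x \<le> ln x" if "0 < x" for x :: real
  using ln_le_minus_one[of "1 / x"] that by (simp add: ln_div)

text \<open>
Put \<open>v = r ln x\<close>. From \<open>n (x - 1) = x (x ^ r - 1)\<close> and \<open>x - 1 \<le> 2 ln x\<close> one gets
\<open>exp v - 1 \<le> 2 v n / r\<close>. If \<open>n / r < exp (v / 2)\<close>, this gives \<open>exp (v / 2) < 2 v + 1\<close>, which is
false once \<open>v \<ge> 6\<close>; hence \<open>v \<le> 2 ln (n / r)\<close>.
\<close>

lemma saddle_point_minus_one_le:
  assumes x: "1 < x" "x \<le> 2" and r: "1 \<le> r" and n: "(\<Sum>j=1..r. x ^ j) = n" and y: "3 \<le> ln (n / r)"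
  shows "real r * (x - 1) \<le> 4 * ln (n / r)"
proof -
  define v where "v = r * ln x"
  define Y where "Y = n / r"
  have "(x - 1) / 2 \<le> (x - 1) / x"
    using x by (intro divide_left_mono) auto
  also have "\<dots> = 1 - 1 / x"
    using x by (simp add: diff_divide_distrib)
  also have "\<dots> \<le> ln x"
    using x by (intro one_minus_inverse_le_ln) simp
  finally have "x - 1 \<le> 2 * ln x"
    by simp
  then have xv: "r * (x - 1) \<le> 2 * v"
    using mult_left_mono[of "x - 1" "2 * ln x" "real r"] by (simp add: v_def)
  have Y: "0 < Y"
    using x r unfolding Y_def n[symmetric] by (intro divide_pos_pos sum_pos) auto
  have "v \<le> 2 * ln Y"
  proof (rule ccontr)
    assume "\<not> v \<le> 2 * ln Y"
    then have v: "2 * ln Y < v" by simp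
    then have v6: "6 \<le> v"
      using y by (simp add: Y_def)
    have "Y = exp (ln Y)"
      using Y by simp
    also have "\<dots> \<le> exp (v / 2)"
      using v by simp
    finally have Yv: "Y \<le> exp (v / 2)" .
    have "exp v = x ^ r"
      using x by (simp add: v_def exp_of_nat_mult)
    then have "exp v - 1 \<le> x * (x ^ r - 1)"
      using x one_le_power[of x r] mult_right_mono[of 1 x "x ^ r - 1"] by simp
    also have "\<dots> = n * (x - 1)"
      using geometric_sum_from_1[of x r] n by simp
    also have "\<dots> = Y * (r * (x - 1))"
      using r by (simp add: Y_def)
    also have "\<dots> \<le> exp (v / 2) * (2 * v)"
      by (rule mult_mono[OF Yv xv]) (use x in auto)
    finally have "exp v \<le> exp (v / 2) * (2 * v) + 1" by simp
    also have "\<dots> < exp (v / 2) * (2 * v) + exp (v / 2)"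
      using v6 by simp
    also have "\<dots> = exp (v / 2) * (4 * (v / 2) + 1)"
      by (simp add: algebra_simps)
    also have "\<dots> \<le> exp (v / 2) * exp (v / 2)"
      using v6 four_times_plus_one_le_exp[of "v / 2"] by (intro mult_left_mono) auto
    also have "\<dots> = exp v"
      by (simp add: mult_exp_exp)
    finally show False by simp
  qed
  then show ?thesis
    using xv unfolding Y_def by linarith
qed

lemma saddle_point_gt_1:
  assumes "1 \<le> r" "real r < n" "0 < x" "(\<Sum>j=1..r. x ^ j) = n"
  shows "1 < x"
proof (rule ccontr)
  assume "\<not> 1 < x"
  then have "(\<Sum>j=1..r. x ^ j) \<le> (\<Sum>j=1..r. 1)"
    using assms by (intro sum_mono) (auto intro: power_le_one)
  then show False
    using assms by simp
qed

lemma saddle_point_large_bounds: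
  assumes x: "2 < x" and r: "2 \<le> r" and n: "(\<Sum>j=1..r. x ^ j) = n"
  shows "real r \<le> 2 * ln n" and "x \<le> sqrt n"
proof -
  have "x ^ r \<le> (\<Sum>j=1..r. x ^ j)"
    using x r by (intro member_le_sum) auto
  then have xr: "x ^ r \<le> n"
    using n by simp
  have "x ^ 2 \<le> x ^ r"
    using x r by (intro power_increasing) auto
  then have "x ^ 2 \<le> n"
    using xr by simp
  then show "x \<le> sqrt n"
    by (rule real_le_rsqrt)
  have "ln 2 \<ge> (1 / 2 :: real)"
    using one_minus_inverse_le_ln[of 2] by simp
  then have "r * (1 / 2) \<le> r * ln 2"
    by (intro mult_left_mono) auto
  also have "\<dots> = ln (2 ^ r)"
    by (simp add: ln_realpow)
  also have "\<dots> \<le> ln n"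
  proof -
    have "(2::real) ^ r \<le> x ^ r"
      using x by (intro power_mono) auto
    then have "2 ^ r \<le> n"
      using xr by simp
    moreover have "(0::real) < 2 ^ r" by simp
    ultimately show ?thesis
      by (subst ln_le_cancel_iff) linarith+
  qed
  finally show "real r \<le> 2 * ln n" by simp
qed

section \<open>Decay on the outer arc\<close>

text \<open>
Put \<open>y = n / r\<close> and \<open>l = ln n\<close>. The essential case is \<open>x \<le> 2\<close>, where \<open>r (x - 1) \<le> 4 ln y\<close> reduces the
claim to \<open>y / (32 (ln y)^2) \<ge> 9 / 4 l\<close>. If \<open>y \<le> l^2\<close> then \<open>ln y \<le> 2 ln l\<close>, and the hypothesis is exactly
what is needed: \<open>9 / 4 * 32 * 4 = 288\<close>. If \<open>y > l^2\<close> then the growth of \<open>y\<close> alone suffices. For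
\<open>x > 2\<close>, \<open>r\<close> is at most \<open>2 l\<close> and \<open>x\<close> at most \<open>sqrt n\<close>, so there is a power of \<open>n\<close> to spare.

The constant \<open>9 / 4\<close> leaves room to absorb the additive constant \<open>4\<close> of \<open>Re_saddle_exponent_outer_le\<close>
and still have decay \<open>2 l\<close>.
\<close>

lemma outer_decay_rate:
  "\<forall>\<^sub>F n in sequentially. \<forall>r x. 2 \<le> r \<longrightarrow>
    288 * ln n * (ln (ln n)) ^ 2 \<le> real n / real r \<longrightarrow> 0 < x \<longrightarrow> (\<Sum>j=1..r. x ^ j) = real n \<longrightarrow>
    9 / 4 * ln n \<le> real n / real r * (min (1 / 2) (3 * x / (2 * (real r * (x - 1)) ^ 2)) / 3)"
proof -
  have "eventually (\<lambda>y::real. 72 * (ln y) ^ 2 \<le> sqrt y \<and> 3 \<le> ln y) at_top"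
    by (intro eventually_conj; real_asymp)
  then obtain Y where Y: "72 * (ln y) ^ 2 \<le> sqrt y" "3 \<le> ln y" if "Y \<le> y" for y :: real
    unfolding eventually_at_top_linorder by blast
  have 1: "eventually (\<lambda>n. Y \<le> ln (real n) \<and> 1 \<le> ln (ln (real n)) \<and>  1 \<le> ln (real n)) sequentially"
    by (intro eventually_conj; real_asymp)
  have 2: "eventually (\<lambda>n. 9 / 4 * ln (real n) \<le> sqrt (real n) / (16 * ln (real n) ^ 3)) sequentially"
    by real_asymp
  show ?thesis
    using 1 2
  proof eventually_elim
    case (elim n)
    define l where "l = ln (real n)"
    have l: "Y \<le> l" "1 \<le> ln l" "1 \<le> l" "9 / 4 * l \<le> sqrt (real n) / (16 * l ^ 3)"
      using elim by (auto simp: l_def)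
    show ?case
    proof (intro allI impI)
      fix r :: nat and x :: real
      assume r: "2 \<le> r" and hyp: "288 * ln n * (ln (ln n)) ^ 2 \<le> real n / real r"
        and x0: "0 < x" and n: "(\<Sum>j=1..r. x ^ j) = real n"
      define y where "y = real n / real r"
      have hyp: "288 * l * (ln l) ^ 2 \<le> y"
        using hyp by (simp add: y_def l_def)
      have "288 * l * 1 \<le> 288 * l * (ln l) ^ 2"
        using l by (intro mult_left_mono one_le_power) auto
      then have yl: "288 * l \<le> y"
        using hyp by simp
      then have y: "Y \<le> y" "1 < y"
        using l by linarith+
      then have x: "1 < x"
        using saddle_point_gt_1[OF _ _ x0 n] r by (simp add: y_def field_simps)
      have "9 / 4 * l \<le> y / 6"
        using yl l by linarith
      moreover have "9 / 4 * l \<le> y * (x / (2 * (real r * (x - 1)) ^ 2))"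
      proof (cases "x \<le> 2")
        case True
        have "real r * (x - 1) \<le> 4 * ln y"
          using saddle_point_minus_one_le[OF x True _ n] r Y(2)[OF y(1)] by (simp add: y_def)
        then have "(real r * (x - 1)) ^ 2 \<le> (4 * ln y) ^ 2"
          using x by (intro power_mono) auto
        then have "y * (1 / (2 * (4 * ln y) ^ 2)) \<le> y * (x / (2 * (real r * (x - 1)) ^ 2))"
          using x y r by (intro mult_left_mono frac_le) auto
        moreover have "9 / 4 * l \<le> y * (1 / (2 * (4 * ln y) ^ 2))"
        proof (cases "y \<le> l ^ 2")
          case True
          have "ln y \<le> ln (l ^ 2)"
            using True y l by (subst ln_le_cancel_iff) auto
          also have "\<dots> = 2 * ln l"
            using l by (simp add: ln_realpow)
          finally have "(ln y) ^ 2 \<le> (2 * ln l) ^ 2"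
            using y by (intro power_mono) auto
          then have "9 / 4 * l * (32 * (ln y) ^ 2) \<le> 9 / 4 * l * (32 * (2 * ln l) ^ 2)"
            using l by (intro mult_left_mono) auto
          \<comment> \<open>this is where the factor \<open>(ln l) ^ 2\<close> of the hypothesis is needed\<close>
          also have "\<dots> \<le> y"
            using hyp by (simp add: power_mult_distrib)
          finally show ?thesis
            using Y(2)[OF y(1)] by (simp add: field_simps)
        next
          case False
          then have "l \<le> sqrt y"
            using l by (intro real_le_rsqrt) auto
          then have "9 / 4 * l * (32 * (ln y) ^ 2) \<le> sqrt y * (72 * (ln y) ^ 2)"
            using mult_right_mono[of l "sqrt y" "72 * (ln y) ^ 2"] by simp
          also have "\<dots> \<le> sqrt y * sqrt y"
            using Y(1)[OF y(1)] y by (intro mult_left_mono) auto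
          also have "\<dots> = y"
            using y by simp
          finally show ?thesis
            using Y(2)[OF y(1)] by (simp add: field_simps)
        qed
        ultimately show ?thesis
          by linarith
      next
        case False
        then have r2: "real r \<le> 2 * l" and xs: "x \<le> sqrt n"
          using saddle_point_large_bounds[OF _ r n] by (auto simp: l_def)
        have "0 < real n"
          using y by (cases "n = 0") (auto simp: y_def)
        have "s / (16 * l ^ 3) = (s * s) / (2 * (2 * l) ^ 3 * s)" if "0 < s" for s
          using that by (simp add: power_mult_distrib)
        from this[of "sqrt n"] have "sqrt n / (16 * l ^ 3) = (sqrt n * sqrt n) / (2 * (2 * l) ^ 3 * sqrt n)"
          using \<open>0 < real n\<close> by simp
        also have "\<dots> = real n / (2 * (2 * l) ^ 3 * sqrt n)"
          by simp
        also have "\<dots> \<le> real n / (2 * real r ^ 3 * x)"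
          using r r2 xs x l \<open>0 < real n\<close> by (intro divide_left_mono mult_mono power_mono mult_pos_pos) auto
        also have "\<dots> = y * (x / (2 * (real r * x) ^ 2))"
          using x r by (simp add: y_def power_mult_distrib eval_nat_numeral)
        also have "\<dots> \<le> y * (x / (2 * (real r * (x - 1)) ^ 2))"
          using x r y by (intro mult_left_mono divide_left_mono power_mono mult_pos_pos) auto
        finally show ?thesis
          using l by linarith
      qed
      ultimately show "9 / 4 * ln n \<le> real n / real r * (min (1 / 2) (3 * x / (2 * (real r * (x - 1)) ^ 2)) / 3)"
        unfolding l_def[symmetric] y_def[symmetric] by (simp add: min_def)
    qed
  qed
qed


section \<open>The asymptotic formula\<close>

definition saddle_approx :: "nat \<Rightarrow> nat \<Rightarrow> real" where
  "saddle_approx n r = (let x = saddle_point n r in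
     exp (\<Sum>j=1..r. x ^ j / real j) / (x ^ n * sqrt (2 * pi * saddle_variance r x)))"

text \<open>
The quotient of \<open>\<nu>(n, r)\<close> and its approximation is the saddle integral divided by \<open>sqrt (2 \<pi> / \<lambda>)\<close>, so
an absolute error of the integral has to be compared with \<open>sqrt (2 \<pi> / \<lambda>)\<close>. For the outer arc
\<open>\<lambda> \<le> r n \<le> n^2\<close> shows that \<open>1 / n^2\<close> is small enough.
\<close>

lemma saddle_approx_relative_error:
  assumes r: "1 \<le> r" and nr: "2 * real r \<le> real n"
    and large: "16 \<le> ln n"
    and rate: "\<And>x. 2 \<le> r \<Longrightarrow> 0 < x \<Longrightarrow> (\<Sum>j=1..r. x ^ j) = real n \<Longrightarrow>
      9 / 4 * ln n \<le> real n / real r * (min (1 / 2) (3 * x / (2 * (real r * (x - 1)) ^ 2)) / 3)"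
  shows "\<bar>nu n r / saddle_approx n r - 1\<bar> \<le> 20000 * (real r / real n)"
proof -
  define x where "x = saddle_point n r"
  define L where "L = saddle_variance r x"
  define I where "I = integral {-pi..pi} (\<lambda>t. Re (exp (saddle_exponent r x t)))"
  define e where "e = 1 / real n ^ 2"
  have n0: "0 < real n" and r0: "0 < real r"
    using nr r by auto
  have x0: "0 < x" and n: "(\<Sum>j=1..r. x ^ j) = real n"
    using saddle_point[of n r] r n0 by (auto simp: x_def)
  have x1: "1 < x"
    using saddle_point_gt_1[OF r _ x0 n] nr r0 by simp
  have L_le: "L \<le> real r * n"
    using saddle_variance_le[of x r] x0 n by (simp add: L_def)
  have "real r * n / 2 \<le> real (r + 1) / 2 * n"
    using n0 by (simp add: algebra_simps)
  then have L_ge: "real r * n / 2 \<le> L"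
    using saddle_variance_ge[of x r] x1 n by (simp add: L_def)
  have L0: "0 < L"
    using L_ge r0 n0 by (smt (verit) divide_pos_pos mult_pos_pos)
  define s where "s = sqrt (2 * pi / L)"
  have s0: "0 < s"
    using L0 by (simp add: s_def)
  have outer: "\<bar>Re (exp (saddle_exponent r x t))\<bar> \<le> e" if t: "pi < real r * \<bar>t\<bar>" "\<bar>t\<bar> \<le> pi" for t
  proof -
    \<comment> \<open>for \<open>r = 1\<close> the central arc is the whole circle\<close>
    have "r \<noteq> 1"
      using t by auto
    then have "9 / 4 * ln n \<le> real n / real r * (min (1 / 2) (3 * x / (2 * (real r * (x - 1)) ^ 2)) / 3)"
      using r by (intro rate x0 n) simp
    then have "Re (saddle_exponent r x t) \<le> 4 - 9 / 4 * ln n"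
      using Re_saddle_exponent_outer_le[OF x1 r n nr less_imp_le[OF t(1)] t(2)] by linarith
    also have "\<dots> \<le> - (2 * ln n)"
      using large by simp
    finally have "exp (Re (saddle_exponent r x t)) \<le> exp (- (2 * ln n))"
      by simp
    also have "\<dots> = e"
      using n0 by (simp add: e_def exp_minus exp_double inverse_eq_divide)
    finally have "norm (exp (saddle_exponent r x t)) \<le> e"
      by simp
    then show ?thesis
      using abs_Re_le_cmod order.trans by blast
  qed
  have "\<bar>I - sqrt (2 * pi / L)\<bar> \<le> 2400 * (real r ^ 2 / L) * sqrt (24 * pi / L) + 2 * pi * e"
    unfolding I_def
  proof (rule integral_close_to_gaussian[OF _ L0])
    show "continuous_on {-pi..pi} (\<lambda>t. Re (exp (saddle_exponent r x t)))"
      by (intro continuous_intros)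
    fix t
    have e: "0 \<le> (if t \<in> {-pi..pi} then e else 0)"
      by (simp add: e_def)
    show "\<bar>(if t \<in> {-pi..pi} then Re (exp (saddle_exponent r x t)) else 0) - exp (- (L / 2 * t ^ 2))\<bar> \<le>
      2400 * (real r ^ 2 / L) * exp (- (L / 24 * t ^ 2)) + (if t \<in> {-pi..pi} then e else 0)"
    proof (cases "real r * \<bar>t\<bar> \<le> pi")
      case True
      have "1 * \<bar>t\<bar> \<le> real r * \<bar>t\<bar>"
        using r by (intro mult_right_mono) auto
      then have "t \<in> {-pi..pi}"
        using True by auto
      then show ?thesis
        using central_estimate[of x r t] x0 L0 True e unfolding L_def by simp
    next
      case False
      then have "exp (- (L / 2 * t ^ 2)) \<le> 2400 * (real r ^ 2 / L) * exp (- (L / 24 * t ^ 2))"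
        by (intro gaussian_tail_estimate L0) simp
      moreover have "\<bar>(if t \<in> {-pi..pi} then Re (exp (saddle_exponent r x t)) else 0)\<bar> \<le>
          (if t \<in> {-pi..pi} then e else 0)"
        using outer[of t] False by auto
      moreover have "0 < exp (- (L / 2 * t ^ 2))"
        by simp
      ultimately show ?thesis
        by linarith
    qed
  qed
  moreover have "sqrt (24 * pi / L) = sqrt 12 * s"
    by (simp add: s_def flip: real_sqrt_mult)
  ultimately have main: "\<bar>I - s\<bar> \<le> (2400 * (real r ^ 2 / L) * sqrt 12) * s + 2 * pi * e"
    by (simp add: s_def)
  have ratio: "nu n r / saddle_approx n r = I / sqrt (2 * pi / L)"
  proof -
    have "nu n r / saddle_approx n r = I * sqrt (2 * pi * L) / (2 * pi)"
      using nu_eq_saddle_integral[OF x0 n] x0 L0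
      by (simp add: saddle_approx_def Let_def x_def[symmetric] L_def[symmetric] I_def[symmetric])
    also have "\<dots> = I / sqrt (2 * pi / L)"
      using L0 by (simp add: real_sqrt_mult real_sqrt_divide field_simps)
    finally show ?thesis .
  qed
  have "\<bar>nu n r / saddle_approx n r - 1\<bar> = \<bar>I - s\<bar> / s"
  proof -
    have "I / s - 1 = (I - s) / s"
      using s0 by (simp add: diff_divide_distrib)
    then show ?thesis
      unfolding ratio s_def[symmetric] using s0 by simp
  qed
  also have "\<dots> \<le> ((2400 * (real r ^ 2 / L) * sqrt 12) * s + 2 * pi * e) / s"
    using main s0 by (intro divide_right_mono) auto
  also have "\<dots> = 2400 * (real r ^ 2 / L) * sqrt 12 + 2 * pi * e / s"
    using s0 by (simp add: add_divide_distrib)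
  also have "2400 * (real r ^ 2 / L) * sqrt 12 \<le> 2400 * (2 * (real r / n)) * 4"
  proof (intro mult_mono)
    have "real r ^ 2 / L \<le> real r ^ 2 / (real r * n / 2)"
      using L_ge L0 r0 n0 by (intro divide_left_mono) auto
    then show "real r ^ 2 / L \<le> 2 * (real r / n)"
      using r0 by (simp add: power2_eq_square mult.commute)
    show "sqrt 12 \<le> 4"
      by (rule real_le_lsqrt) auto
  qed (use L0 in auto)
  also have "2 * pi * e / s \<le> 8 * (real r / n)"
  proof -
    have "sqrt (2 * pi) \<le> 4"
      using pi_less_4 by (intro real_le_lsqrt) auto
    have "sqrt L \<le> n"
    proof (rule real_le_lsqrt)
      have "real r * n \<le> real n * real n"
        using nr r0 by (intro mult_right_mono) auto
      then show "L \<le> real n ^ 2"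
        using L_le by (simp add: power2_eq_square)
    qed (use n0 in simp)
    have "2 * pi * e / s = sqrt (2 * pi) * sqrt L * e"
      using L0 by (simp add: s_def real_sqrt_divide real_sqrt_mult field_simps)
    also have "\<dots> \<le> 4 * n * e"
      using mult_mono[OF \<open>sqrt (2 * pi) \<le> 4\<close> \<open>sqrt L \<le> n\<close>] L0
      by (intro mult_right_mono) (simp_all add: e_def)
    also have "\<dots> = 4 * (1 / n)"
      using n0 by (simp add: e_def power2_eq_square)
    also have "\<dots> \<le> 8 * (real r / n)"
      using r n0 by (intro mult_mono divide_right_mono) auto
    finally show ?thesis .
  qed
  finally show ?thesis
    using r0 n0 by (simp add: field_simps)
qed

text \<open>
The constant in the hypothesis on \<open>r\<close> enters only through \<open>12 \<pi>^2 e \<ge> 288\<close>.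
\<close>

lemma eventually_saddle_approx_relative_error:
  "\<forall>\<^sub>F n in sequentially. \<forall>r. 1 \<le> r \<longrightarrow>
    real r \<le> 1 / (12 * pi\<^sup>2 * exp 1) * real n / (ln (real n) * (ln (ln (real n)))\<^sup>2) \<longrightarrow>
    \<bar>nu n r / saddle_approx n r - 1\<bar> \<le> 20000 * (real r / real n)"
proof -
  have "\<forall>\<^sub>F n in sequentially. 16 \<le> ln (real n) \<and> 1 \<le> ln (ln (real n))"
    by (intro eventually_conj; real_asymp)
  then show ?thesis
    using outer_decay_rate
  proof eventually_elim
    case (elim n)
    show ?case
    proof (intro allI impI)
      fix r :: nat
      assume r: "1 \<le> r"
        and hyp: "real r \<le> 1 / (12 * pi\<^sup>2 * exp 1) * real n / (ln (real n) * (ln (ln (real n)))\<^sup>2)"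
      define D where "D = ln (real n) * (ln (ln (real n)))\<^sup>2"
      have "1 * 1 \<le> D"
        unfolding D_def using elim by (intro mult_mono one_le_power) auto
      then have D: "1 \<le> D" by simp
      have "288 \<le> (12 * pi\<^sup>2 * exp 1 :: real)"
      proof -
        have "(3.14 :: real) ^ 2 \<le> pi ^ 2"
          using pi_approx by (intro power_mono) auto
        moreover have "5 / 2 \<le> exp (1 :: real)"
          using exp_lower_Taylor_quadratic[of "1 :: real"] by simp
        ultimately have "(12 * 3.14 ^ 2) * (5 / 2) \<le> (12 * pi\<^sup>2) * exp (1 :: real)"
          by (intro mult_mono) auto
        then show ?thesis
          by (simp add: power2_eq_square)
      qed
      define K :: real where "K = 12 * pi\<^sup>2 * exp 1"
      have K: "288 \<le> K"
        unfolding K_def by fact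
      have "real r \<le> real n / (K * D)"
        using hyp by (simp add: K_def D_def)
      then have "real r * (K * D) \<le> real n"
        using K D by (simp add: field_simps)
      moreover have "real r * (288 * D) \<le> real r * (K * D)"
        using K D by (intro mult_left_mono mult_right_mono) auto
      ultimately have KD: "real r * (288 * D) \<le> real n"
        by linarith
      then have y: "288 * D \<le> real n / real r"
        using r by (simp add: field_simps)
      have "real r * 2 \<le> real r * (288 * D)"
        using D by (intro mult_left_mono) auto
      then have "2 * real r \<le> real n"
        using KD by linarith
      then show "\<bar>nu n r / saddle_approx n r - 1\<bar> \<le> 20000 * (real r / real n)"
        using elim r y by (intro saddle_approx_relative_error) (auto simp: D_def)
    qed
  qed
qed

theorem theorem2p1:
  shows "\<exists>C::real. \<forall>n r :: nat. 4 \<le> n \<longrightarrow> 1 \<le> r \<longrightarrow>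
    real r \<le> 1 / (12 * pi\<^sup>2 * exp 1) * real n / (ln (real n) * (ln (ln (real n)))\<^sup>2) \<longrightarrow>
    (let x = saddle_point n r in
      \<exists>\<delta>::real. \<bar>\<delta>\<bar> \<le> C * (real r / real n) \<and>
        nu n r = exp (\<Sum>j=1..r. x ^ j / real j)
          / (x ^ n * sqrt (2 * pi * (\<Sum>j=1..r. real j * x ^ j))) * (1 + \<delta>))"
proof -
  define b :: "nat \<Rightarrow> real" where
    "b n = 1 / (12 * pi\<^sup>2 * exp 1) * real n / (ln (real n) * (ln (ln (real n)))\<^sup>2)" for n
  define q :: "nat \<Rightarrow> nat \<Rightarrow> real" where
    "q n r = \<bar>nu n r / saddle_approx n r - 1\<bar> / (real r / real n)" for n r
  obtain N where N: "\<bar>nu n r / saddle_approx n r - 1\<bar> \<le> 20000 * (real r / real n)"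
    if "N \<le> n" "1 \<le> r" "real r \<le> b n" for n r
    using eventually_saddle_approx_relative_error unfolding eventually_sequentially b_def by blast
  define S where "S = (SIGMA n:{4..<N}. {r. 1 \<le> r \<and> real r \<le> b n})"
  have "finite {r. 1 \<le> r \<and> real r \<le> b n}" for n
    by (rule finite_subset[of _ "{..nat \<lfloor>b n\<rfloor>}"]) (auto simp: le_nat_floor)
  then have fin: "finite S"
    unfolding S_def by (intro finite_SigmaI) auto
  define C where "C = Max (insert 20000 ((\<lambda>(n, r). q n r) ` S))"
  have "\<bar>nu n r / saddle_approx n r - 1\<bar> \<le> C * (real r / real n)"
    if n: "4 \<le> n" and r: "1 \<le> r" "real r \<le> b n" for n r
  proof -
    have pos: "0 < real r / real n"
      using n r by auto
    have "q n r \<le> C"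
    proof (cases "N \<le> n")
      case True
      then have "q n r \<le> 20000"
        using N[of n r] r pos unfolding q_def by (subst pos_divide_le_eq) auto
      also have "\<dots> \<le> C"
        unfolding C_def using fin by (intro Max_ge) auto
      finally show ?thesis .
    next
      case False
      then have "(n, r) \<in> S"
        using n r by (auto simp: S_def)
      then show ?thesis
        unfolding C_def using fin by (intro Max_ge) auto
    qed
    then show ?thesis
      using pos unfolding q_def by (subst (asm) pos_divide_le_eq) auto
  qed
  moreover have "nu n r = saddle_approx n r * (1 + (nu n r / saddle_approx n r - 1))"
    if "4 \<le> n" "1 \<le> r" for n r
  proof -
    have x0: "0 < saddle_point n r"
      using saddle_point[of n r] that by simp
    then have "0 < saddle_variance r (saddle_point n r)"
      unfolding saddle_variance_def using that by (intro sum_pos) auto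
    then have "saddle_approx n r \<noteq> 0"
      using x0 by (simp add: saddle_approx_def Let_def)
    then show ?thesis by simp
  qed
  ultimately show ?thesis
    unfolding b_def saddle_approx_def saddle_variance_def Let_def by blast
qed

end
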